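(* Let $Q$ be a compact metric space, let $\varphi_1,\dots,\varphi_n$ be linearly independent continuous real-valued functions on $Q$ with span $\mathcal{P}$, and let $\ell$ be a nontrivial linear functional on $\mathcal{P}$. In the $k$th iteration of Algorithm 1 (described in the context) applied to the problem of minimizing $\|\boldsymbol{p}\|_{C(Q)}$ over $\boldsymbol{p}\in\mathcal{P}$ with $\ell(\boldsymbol{p})=1$, we have $$B_{k+1}-b_{k+1}\ \le\ \Bigl(1-\frac{\gamma_0}{\Gamma}\Bigr)\bigl(B_k-b_k\bigr),$$ where $\gamma_0,\ (\gamma_j)_{j\notin\{0,q\}}$ are the numbers computed in the $k$th iteration and $\Gamma=\sum_{i\ne q}\gamma_i$ is the sum over all $i\in\{0,1,\dots,n\}\setminus\{q\}$.
   Context: Notation. Each $\boldsymbol{p}=\sum_i p_i\varphi_i\in\mathcal{P}$ is identified with $(p_1,\dots,p_n)\in\mathbb{R}^n$, and $\ell$ with the vector of $\mathbb{R}^n$ for which $\ell(\boldsymbol{p})=(\boldsymbol{p},\ell)$ (standard inner product). Put $\boldsymbol{u}(t)=(\varphi_1(t),\dots,\varphi_n(t))$, so $\boldsymbol{p}(t)=(\boldsymbol{p},\boldsymbol{u}(t))$, and $\|\boldsymbol{p}\|=\|\boldsymbol{p}\|_{C(Q)}=\max_{t\in Q}|\boldsymbol{p}(t)|$. Algorithm 1. Initialisation. Take a set $\mathcal{T}_1=\{t_1,\dots,t_n\}$ of $n$ different points of $Q$ such that $\boldsymbol{u}(t_1),\dots,\boldsymbol{u}(t_n)$ are linearly independent.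 Choose signs $\sigma_i\in\{1,-1\}$ such that, for $\boldsymbol{a}_i=\sigma_i\boldsymbol{u}(t_i)$, one has $\ell=\sum_{i=1}^n\alpha_i\boldsymbol{a}_i$ with positive $\alpha_i$. Find the solution $\boldsymbol{p}_1\in\mathbb{R}^n$, $b_1\in\mathbb{R}$ of the linear system $(\boldsymbol{p}_1,\ell)=1$, $(\boldsymbol{p}_1,\boldsymbol{a}_i)=b_1$, $i=1,\dots,n$ (then $b_1>0$). Set $B_1=\|\boldsymbol{p}_1\|$ and choose $\varepsilon>0$. $k$th iteration, $k\ge1$. One has a set of $n$ points $\mathcal{T}_k=\{t_1,\dots,t_n\}\subset Q$, a polynomial $\boldsymbol{p}_k\in\mathcal{P}$ with $\ell(\boldsymbol{p}_k)=1$, numbers $B_k>b_k>0$, a sign $\sigma\in\{-1,1\}$, and signs $\sigma_i\in\{-1,1\}$ such that $\boldsymbol{p}_k(t_i)=\sigma_i b_k$ for all $i=1,\dots,n$, the vectors $\boldsymbol{a}_i=\sigma_i\boldsymbol{u}(t_i)$, $i=1,\dots,n$, form a basis of $\mathbb{R}^n$, and the coordinates $(\alpha_i)_{i=1}^n$ of $\sigma\ell$ in this basis are all positive. Let $r_k=\|\boldsymbol{p}_k\|_{C(Q)}$ and find $t_0\in Q$ with $|\boldsymbol{p}_k(t_0)|=r_k$. Let $\sigma_0=\mathrm{sign}\,\boldsymbol{p}_k(t_0)$, $\boldsymbol{a}_0=\sigma_0\boldsymbol{u}(t_0)$, and let $(s_i)_{i=1}^n$ be the coordinates of $\boldsymbol{a}_0$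 in the basis $\{\boldsymbol{a}_i\}_{i=1}^n$. Let $q\in\{1,\dots,n\}$ be an index at which the maximum of $s_i/\alpha_i$, $i=1,\dots,n$, is attained. Define $\mathcal{T}_{k+1}$ as $\mathcal{T}_k$ with $t_q$ replaced by $t_0$, and set $\gamma_0=\bigl|\frac{\alpha_q}{s_q}\bigr|$ and $\gamma_j=\bigl|\alpha_j-\frac{\alpha_q s_j}{s_q}\bigr|$ for $j\in\{1,\dots,n\}\setminus\{q\}$; then $\mathrm{sign}(s_q)\,\sigma\,\ell=\sum_{i\in\{0,\dots,n\},\,i\ne q}\gamma_i\boldsymbol{a}_i$. Find the solution $\boldsymbol{p}\in\mathbb{R}^n$, $r\in\mathbb{R}$ of the linear system $(\boldsymbol{p},\ell)=1$, $(\boldsymbol{p},\boldsymbol{a}_i)=r$ for all $i\in\{0,\dots,n\}\setminus\{q\}$, and set $\boldsymbol{p}_{k+1}=\boldsymbol{p}$, $b_{k+1}=r$. Set $B_{k+1}=\min\{r_k,B_k\}$. Finally, relabel the points of $\mathcal{T}_{k+1}$ (with the corresponding vectors) as $t_1,\dots,t_n$ in any order. Termination. Stop if $B_k-b_k<\varepsilon$. *)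

theory Defs
  imports "HOL-Analysis.Analysis"
begin

text \<open>
  The compact metric space \<open>Q\<close> is the type \<open>'q\<close> (with \<^term>\<open>compact UNIV\<close> assumed in the theorem),
  so that \<open>C(Q)\<close> is the library's \<open>'q \<Rightarrow>\<^sub>C real\<close> with its supremum norm. The number \<open>n\<close> is \<open>CARD('n)\<close>;
  the type \<open>'n\<close> indexes both the functions \<open>\<phi>\<close> and the points of the sets \<open>T\<^sub>k\<close>.
\<close>

definition poly_span :: "('n::finite \<Rightarrow> 'q::metric_space \<Rightarrow>\<^sub>C real) \<Rightarrow> ('q \<Rightarrow>\<^sub>C real) set" where
  "poly_span \<phi> = span (range \<phi>)"

definition polynomial :: "('n::finite \<Rightarrow> 'q::metric_space \<Rightarrow>\<^sub>C real) \<Rightarrow> real ^ 'n \<Rightarrow> 'q \<Rightarrow>\<^sub>C real" where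
  "polynomial \<phi> p = (\<Sum>i\<in>UNIV. (p $ i) *\<^sub>R \<phi> i)"

definition u_vec :: "('n::finite \<Rightarrow> 'q::metric_space \<Rightarrow>\<^sub>C real) \<Rightarrow> 'q \<Rightarrow> real ^ 'n" where
  "u_vec \<phi> t = (\<chi> i. apply_bcontfun (\<phi> i) t)"

text \<open>Linearity is required on the subspace only; values of \<open>f\<close> outside \<open>V\<close> are irrelevant.\<close>

definition linear_functional_on :: "'v::real_vector set \<Rightarrow> ('v \<Rightarrow> real) \<Rightarrow> bool" where
  "linear_functional_on V f \<longleftrightarrow>
     (\<forall>x\<in>V. \<forall>y\<in>V. f (x + y) = f x + f y) \<and> (\<forall>c. \<forall>x\<in>V. f (c *\<^sub>R x) = c * f x)"

text \<open>
  The vector identified with the functional \<open>L\<close>: for \<open>L\<close> linear on \<^term>\<open>poly_span \<phi>\<close> it is the vector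
  \<open>\<ell>\<close> with \<open>L (polynomial \<phi> p) = p \<bullet> \<ell>\<close> for all \<open>p\<close>.
\<close>

definition functional_vec ::
  "('n::finite \<Rightarrow> 'q::metric_space \<Rightarrow>\<^sub>C real) \<Rightarrow> (('q \<Rightarrow>\<^sub>C real) \<Rightarrow> real) \<Rightarrow> real ^ 'n" where
  "functional_vec \<phi> L = (\<chi> i. L (\<phi> i))"

text \<open>The data passed from one iteration to the next:
  \<open>t\<^sub>i\<close>, \<open>\<sigma>\<^sub>i\<close>, \<open>\<sigma>\<close>, \<open>p\<^sub>k\<close>, \<open>b\<^sub>k\<close>, \<open>B\<^sub>k\<close>.\<close>

record ('q, 'n::finite) alg_state =
  st_point :: "'n \<Rightarrow> 'q"
  st_sign :: "'n \<Rightarrow> real"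
  st_sigma :: real
  st_poly :: "real ^ 'n"
  st_lower :: real
  st_upper :: real

text \<open>The quantities found or chosen within an iteration:
  \<open>\<alpha>\<^sub>i\<close>, \<open>t\<^sub>0\<close>, \<open>s\<^sub>i\<close>, \<open>q\<close>.\<close>

record ('q, 'n) iter_data =
  it_alpha :: "'n \<Rightarrow> real"
  it_point :: 'q
  it_s :: "'n \<Rightarrow> real"
  it_q :: 'n

definition a_vec ::
  "('n::finite \<Rightarrow> 'q::metric_space \<Rightarrow>\<^sub>C real) \<Rightarrow> ('q, 'n) alg_state \<Rightarrow> 'n \<Rightarrow> real ^ 'n" where
  "a_vec \<phi> S i = st_sign S i *\<^sub>R u_vec \<phi> (st_point S i)"

definition sigma0 ::
  "('n::finite \<Rightarrow> 'q::metric_space \<Rightarrow>\<^sub>C real) \<Rightarrow> ('q, 'n) alg_state \<Rightarrow> ('q, 'n) iter_data \<Rightarrow> real" where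
  "sigma0 \<phi> S D = sgn (apply_bcontfun (polynomial \<phi> (st_poly S)) (it_point D))"

definition a0_vec ::
  "('n::finite \<Rightarrow> 'q::metric_space \<Rightarrow>\<^sub>C real) \<Rightarrow> ('q, 'n) alg_state \<Rightarrow> ('q, 'n) iter_data \<Rightarrow> real ^ 'n" where
  "a0_vec \<phi> S D = sigma0 \<phi> S D *\<^sub>R u_vec \<phi> (it_point D)"

definition gamma0 :: "('q, 'n) iter_data \<Rightarrow> real" where
  "gamma0 D = \<bar>it_alpha D (it_q D) / it_s D (it_q D)\<bar>"

definition gamma :: "('q, 'n) iter_data \<Rightarrow> 'n \<Rightarrow> real" where
  "gamma D j = \<bar>it_alpha D j - it_alpha D (it_q D) * it_s D j / it_s D (it_q D)\<bar>"

definition Gamma_sum :: "('q, 'n::finite) iter_data \<Rightarrow> real" where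
  "Gamma_sum D = gamma0 D + (\<Sum>j\<in>UNIV - {it_q D}. gamma D j)"

definition initial_state ::
  "('n::finite \<Rightarrow> 'q::metric_space \<Rightarrow>\<^sub>C real) \<Rightarrow> (('q \<Rightarrow>\<^sub>C real) \<Rightarrow> real) \<Rightarrow> ('q, 'n) alg_state \<Rightarrow> bool" where
  "initial_state \<phi> L S \<longleftrightarrow>
     inj (st_point S) \<and>
     inj (\<lambda>i. u_vec \<phi> (st_point S i)) \<and> independent (range (\<lambda>i. u_vec \<phi> (st_point S i))) \<and>
     (\<forall>i. st_sign S i \<in> {1, -1}) \<and>
     (\<exists>\<alpha>. (\<forall>i. \<alpha> i > 0) \<and> functional_vec \<phi> L = (\<Sum>i\<in>UNIV. \<alpha> i *\<^sub>R a_vec \<phi> S i)) \<and>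
     st_sigma S = 1 \<and>
     st_poly S \<bullet> functional_vec \<phi> L = 1 \<and>
     (\<forall>i. st_poly S \<bullet> a_vec \<phi> S i = st_lower S) \<and>
     st_upper S = norm (polynomial \<phi> (st_poly S))"

text \<open>
  One iteration, from state \<open>S\<close> to state \<open>S'\<close> with intermediate quantities \<open>D\<close>. The coordinates
  \<open>\<alpha>\<^sub>i\<close> of \<open>\<sigma>\<ell>\<close> have to be positive for the iteration to be performed: this can fail after an iteration
  in which the maximum of \<open>s\<^sub>i / \<alpha>\<^sub>i\<close> is attained at several indices. The other properties available at
  the start of an iteration (\<open>b > 0\<close>, \<open>p(t\<^sub>i) = \<sigma>\<^sub>i b\<close>, the \<open>a\<^sub>i\<close> form a basis, \<open>\<ell>(p) = 1\<close>) are
  not imposed here, since \<open>initial_state\<close> establishes them and the iteration preserves them.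
  The bijection \<open>\<pi>\<close> is the relabelling of the new points, signs and vectors.
\<close>

definition iteration ::
  "('n::finite \<Rightarrow> 'q::metric_space \<Rightarrow>\<^sub>C real) \<Rightarrow> (('q \<Rightarrow>\<^sub>C real) \<Rightarrow> real) \<Rightarrow>
   ('q, 'n) alg_state \<Rightarrow> ('q, 'n) iter_data \<Rightarrow> ('q, 'n) alg_state \<Rightarrow> bool" where
  "iteration \<phi> L S D S' \<longleftrightarrow>
     (\<forall>i. it_alpha D i > 0) \<and>
     st_sigma S *\<^sub>R functional_vec \<phi> L = (\<Sum>i\<in>UNIV. it_alpha D i *\<^sub>R a_vec \<phi> S i) \<and>
     \<bar>apply_bcontfun (polynomial \<phi> (st_poly S)) (it_point D)\<bar> = norm (polynomial \<phi> (st_poly S)) \<and>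
     a0_vec \<phi> S D = (\<Sum>i\<in>UNIV. it_s D i *\<^sub>R a_vec \<phi> S i) \<and>
     (\<forall>i. it_s D i / it_alpha D i \<le> it_s D (it_q D) / it_alpha D (it_q D)) \<and>
     (\<exists>\<pi>. bij \<pi> \<and>
        st_point S' = (st_point S)(it_q D := it_point D) \<circ> \<pi> \<and>
        st_sign S' = (st_sign S)(it_q D := sigma0 \<phi> S D) \<circ> \<pi>) \<and>
     st_sigma S' = sgn (it_s D (it_q D)) * st_sigma S \<and>
     st_poly S' \<bullet> functional_vec \<phi> L = 1 \<and>
     st_poly S' \<bullet> a0_vec \<phi> S D = st_lower S' \<and>
     (\<forall>i. i \<noteq> it_q D \<longrightarrow> st_poly S' \<bullet> a_vec \<phi> S i = st_lower S') \<and>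
     st_upper S' = min (norm (polynomial \<phi> (st_poly S))) (st_upper S)"

text \<open>
  A run of the algorithm with tolerance \<open>\<epsilon>\<close> in which iterations \<open>1, \<dots>, k\<close> are carried out; iteration
  \<open>j\<close> leads from \<open>S j\<close> to \<open>S (Suc j)\<close>, and the stopping criterion is not met before it.
\<close>

definition algorithm_run ::
  "('n::finite \<Rightarrow> 'q::metric_space \<Rightarrow>\<^sub>C real) \<Rightarrow> (('q \<Rightarrow>\<^sub>C real) \<Rightarrow> real) \<Rightarrow> real \<Rightarrow> nat \<Rightarrow>
   (nat \<Rightarrow> ('q, 'n) alg_state) \<Rightarrow> (nat \<Rightarrow> ('q, 'n) iter_data) \<Rightarrow> bool" where
  "algorithm_run \<phi> L \<epsilon> k S D \<longleftrightarrow>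
     initial_state \<phi> L (S 1) \<and>
     (\<forall>j\<in>{1..k}. \<not> st_upper (S j) - st_lower (S j) < \<epsilon> \<and> iteration \<phi> L (S j) (D j) (S (Suc j)))"

end

theory Submission
  imports Defs
begin

text \<open>
  At the start of every iteration \<open>\<sigma> = 1\<close>: pairing \<open>a\<^sub>0\<close> with \<open>p\<^sub>k\<close> gives \<open>r\<^sub>k = b\<^sub>k \<Sum>\<^sub>i s\<^sub>i > 0\<close>, so some
  \<open>s\<^sub>i\<close> is positive, hence \<open>s\<^sub>q > 0\<close> by the choice of \<open>q\<close>, and \<open>\<sigma>\<close> keeps its sign. The choice of \<open>q\<close>
  also makes the exchanged coefficients \<open>\<gamma>\<^sub>j\<close> nonnegative without the absolute values. Pairing
  \<open>\<ell> = \<gamma>\<^sub>0 a\<^sub>0 + \<Sum>\<^sub>j \<gamma>\<^sub>j a\<^sub>j\<close> with \<open>p\<^sub>k\<^sub>+\<^sub>1\<close> and with \<open>p\<^sub>k\<close> gives \<open>b\<^sub>k\<^sub>+\<^sub>1 \<Gamma> = 1 = \<gamma>\<^sub>0 r\<^sub>k + (\<Gamma> - \<gamma>\<^sub>0) b\<^sub>k\<close>. So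
  \<open>b\<^sub>k\<^sub>+\<^sub>1\<close> is the convex combination of \<open>r\<^sub>k\<close> and \<open>b\<^sub>k\<close> with weight \<open>\<gamma>\<^sub>0 / \<Gamma>\<close>, while \<open>B\<^sub>k\<^sub>+\<^sub>1 = min r\<^sub>k B\<^sub>k\<close> is
  at most the same combination of \<open>r\<^sub>k\<close> and \<open>B\<^sub>k\<close>.
\<close>

lemma polynomial_apply:
  "apply_bcontfun (polynomial \<phi> p) t = p \<bullet> u_vec \<phi> t"
proof -
  have "apply_bcontfun (\<Sum>i\<in>A. (p $ i) *\<^sub>R \<phi> i) t = (\<Sum>i\<in>A. p $ i * apply_bcontfun (\<phi> i) t)"
    if "finite A" for A
    using that by induction (auto simp: plus_bcontfun.rep_eq scaleR_bcontfun.rep_eq zero_bcontfun.rep_eq)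
  then show ?thesis
    by (simp add: polynomial_def u_vec_def inner_vec_def)
qed

text \<open>The loop invariant: the part of the state that is carried by induction. Positivity of
  \<open>st_lower\<close> is rederived within each iteration from the positive coordinates
  \<alpha>.\<close>

definition level_state ::
  "('n::finite \<Rightarrow> 'q::metric_space \<Rightarrow>\<^sub>C real) \<Rightarrow> (('q \<Rightarrow>\<^sub>C real) \<Rightarrow> real) \<Rightarrow> ('q, 'n) alg_state \<Rightarrow> bool" where
  "level_state \<phi> L S \<longleftrightarrow>
     st_sigma S = 1 \<and> st_poly S \<bullet> functional_vec \<phi> L = 1 \<and>
     (\<forall>i. st_poly S \<bullet> a_vec \<phi> S i = st_lower S)"

lemma level_state_initial: "initial_state \<phi> L S \<Longrightarrow> level_state \<phi> L S"
  by (simp add: initial_state_def level_state_def)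

context
  fixes \<phi> :: "'n::finite \<Rightarrow> 'q::metric_space \<Rightarrow>\<^sub>C real"
    and L :: "('q \<Rightarrow>\<^sub>C real) \<Rightarrow> real"
    and S S' :: "('q, 'n) alg_state"
    and D :: "('q, 'n) iter_data"
  assumes level: "level_state \<phi> L S"
    and iter: "iteration \<phi> L S D S'"
begin

lemma functional_vec_decomp:
  "functional_vec \<phi> L = (\<Sum>i\<in>UNIV. it_alpha D i *\<^sub>R a_vec \<phi> S i)"
  using level iter by (simp add: level_state_def iteration_def)

lemma alpha_pos: "it_alpha D i > 0"
  using iter by (simp add: iteration_def)

lemma a0_decomp: "a0_vec \<phi> S D = (\<Sum>i\<in>UNIV. it_s D i *\<^sub>R a_vec \<phi> S i)"
  using iter by (simp add: iteration_def)

lemma poly_a_vec: "st_poly S \<bullet> a_vec \<phi> S i = st_lower S"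
  using level by (simp add: level_state_def)

text \<open>Pairing the expansion of the functional with \<open>st_poly S\<close> turns every basis
  vector into the same number \<open>st_lower S\<close>.\<close>

lemma lower_pos: "st_lower S > 0"
proof -
  have "1 = st_poly S \<bullet> functional_vec \<phi> L"
    using level by (simp add: level_state_def)
  also have "\<dots> = (\<Sum>i\<in>UNIV. it_alpha D i) * st_lower S"
    by (simp add: functional_vec_decomp inner_sum_right poly_a_vec sum_distrib_right)
  finally have "1 = (\<Sum>i\<in>UNIV. it_alpha D i) * st_lower S" .
  moreover have "(\<Sum>i\<in>UNIV. it_alpha D i) > 0"
    by (rule sum_pos) (auto simp: alpha_pos)
  ultimately show ?thesis
    by (metis zero_less_mult_pos zero_less_one)
qed

lemma norm_polynomial_pos: "norm (polynomial \<phi> (st_poly S)) > 0"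
proof -
  have "st_poly S \<bullet> u_vec \<phi> (st_point S i) \<noteq> 0" for i
    using poly_a_vec[of i] lower_pos by (auto simp: a_vec_def)
  then show ?thesis
    using polynomial_apply[of \<phi> "st_poly S"] by (metis zero_bcontfun.rep_eq zero_less_norm_iff)
qed

text \<open>The sign in \<open>a0_vec\<close> turns the extremal value of the polynomial into its
  absolute value.\<close>

lemma poly_a0_vec: "st_poly S \<bullet> a0_vec \<phi> S D = norm (polynomial \<phi> (st_poly S))"
proof -
  have "\<bar>st_poly S \<bullet> u_vec \<phi> (it_point D)\<bar> = norm (polynomial \<phi> (st_poly S))"
    using iter by (simp add: iteration_def polynomial_apply)
  then show ?thesis
    by (simp add: a0_vec_def sigma0_def polynomial_apply abs_sgn mult.commute)
qed

lemma s_q_pos: "it_s D (it_q D) > 0"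
proof -
  have "(\<Sum>i\<in>UNIV. it_s D i) * st_lower S = norm (polynomial \<phi> (st_poly S))"
    using poly_a0_vec by (simp add: a0_decomp inner_sum_right poly_a_vec sum_distrib_right)
  then have "(\<Sum>i\<in>UNIV. it_s D i) > 0"
    using norm_polynomial_pos lower_pos by (metis zero_less_mult_pos2)
  then obtain i where "it_s D i > 0"
    by (metis not_less sum_nonpos)
  then have "0 < it_s D i / it_alpha D i"
    by (simp add: alpha_pos)
  also have "\<dots> \<le> it_s D (it_q D) / it_alpha D (it_q D)"
    using iter by (simp add: iteration_def)
  finally show ?thesis
    using alpha_pos[of "it_q D"] by (simp add: zero_less_divide_iff)
qed

lemma gamma0_pos: "gamma0 D > 0"
  using s_q_pos alpha_pos[of "it_q D"] by (simp add: gamma0_def)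

lemma gamma_eq: "gamma D j = it_alpha D j - it_alpha D (it_q D) * it_s D j / it_s D (it_q D)"
proof -
  have "it_s D j / it_alpha D j \<le> it_s D (it_q D) / it_alpha D (it_q D)"
    using iter by (simp add: iteration_def)
  then have "it_alpha D (it_q D) * it_s D j / it_s D (it_q D) \<le> it_alpha D j"
    using s_q_pos alpha_pos[of j] alpha_pos[of "it_q D"] by (simp add: field_simps)
  then show ?thesis
    by (simp add: gamma_def)
qed

lemma Gamma_sum_ge: "gamma0 D \<le> Gamma_sum D"
  by (simp add: Gamma_sum_def gamma_def sum_nonneg)

lemma functional_vec_exchange:
  "functional_vec \<phi> L =
     gamma0 D *\<^sub>R a0_vec \<phi> S D + (\<Sum>j\<in>UNIV - {it_q D}. gamma D j *\<^sub>R a_vec \<phi> S j)"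
proof -
  let ?q = "it_q D"
  have g0: "gamma0 D = it_alpha D ?q / it_s D ?q"
    using s_q_pos alpha_pos[of ?q] by (simp add: gamma0_def)
  \<comment> \<open>\<open>gamma0 D\<close> is the multiple of \<open>a0_vec\<close> whose
    subtraction cancels the coordinate at q.\<close>
  have gq: "gamma D ?q = 0"
    using s_q_pos by (simp add: gamma_def)
  have "functional_vec \<phi> L - gamma0 D *\<^sub>R a0_vec \<phi> S D = (\<Sum>j\<in>UNIV. gamma D j *\<^sub>R a_vec \<phi> S j)"
    by (simp add: functional_vec_decomp a0_decomp gamma_eq g0 scaleR_sum_right
        scaleR_left_diff_distrib sum_subtractf)
  also have "\<dots> = (\<Sum>j\<in>UNIV - {?q}. gamma D j *\<^sub>R a_vec \<phi> S j)"
    by (simp add: sum.remove[of UNIV ?q] gq)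
  finally show ?thesis
    by (simp add: algebra_simps)
qed

lemma poly_next:
  "st_poly S' \<bullet> functional_vec \<phi> L = 1"
  "st_poly S' \<bullet> a0_vec \<phi> S D = st_lower S'"
  "i \<noteq> it_q D \<Longrightarrow> st_poly S' \<bullet> a_vec \<phi> S i = st_lower S'"
  using iter unfolding iteration_def by blast+

lemma lower_next: "st_lower S' * Gamma_sum D = 1"
proof -
  have "1 = st_poly S' \<bullet> functional_vec \<phi> L"
    by (simp add: poly_next)
  also have "\<dots> = gamma0 D * st_lower S' + (\<Sum>j\<in>UNIV - {it_q D}. gamma D j * st_lower S')"
    by (simp add: functional_vec_exchange inner_add_right inner_sum_right poly_next)
  finally show ?thesis
    by (simp add: Gamma_sum_def algebra_simps sum_distrib_left)
qed

lemma norm_lower_combination: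
  "gamma0 D * norm (polynomial \<phi> (st_poly S)) + (Gamma_sum D - gamma0 D) * st_lower S = 1"
proof -
  have "1 = st_poly S \<bullet> functional_vec \<phi> L"
    using level by (simp add: level_state_def)
  also have "\<dots> = gamma0 D * norm (polynomial \<phi> (st_poly S))
                   + (\<Sum>j\<in>UNIV - {it_q D}. gamma D j * st_lower S)"
    by (simp add: functional_vec_exchange inner_add_right inner_sum_right poly_a0_vec poly_a_vec)
  finally show ?thesis
    by (simp add: Gamma_sum_def sum_distrib_right)
qed

text \<open>The relabelling is harmless: the new polynomial has the same inner product with all
  exchanged vectors.\<close>

lemma level_state_iteration: "level_state \<phi> L S'"
proof -
  obtain \<pi> where
    "st_point S' = (st_point S)(it_q D := it_point D) \<circ> \<pi>"
    "st_sign S' = (st_sign S)(it_q D := sigma0 \<phi> S D) \<circ> \<pi>"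
    using iter by (auto simp: iteration_def)
  then have "a_vec \<phi> S' i = (if \<pi> i = it_q D then a0_vec \<phi> S D else a_vec \<phi> S (\<pi> i))" for i
    by (simp add: a_vec_def a0_vec_def)
  moreover have "st_sigma S' = 1"
    using level iter s_q_pos by (simp add: level_state_def iteration_def)
  ultimately show ?thesis
    by (simp add: level_state_def poly_next)
qed

lemma gap_iteration:
  "st_upper S' - st_lower S' \<le> (1 - gamma0 D / Gamma_sum D) * (st_upper S - st_lower S)"
proof -
  define \<theta> where "\<theta> = gamma0 D / Gamma_sum D"
  define r where "r = norm (polynomial \<phi> (st_poly S))"
  have G: "Gamma_sum D > 0"
    using gamma0_pos Gamma_sum_ge by linarith
  have \<theta>: "0 \<le> \<theta>" "\<theta> \<le> 1"
    using G gamma0_pos Gamma_sum_ge by (auto simp: \<theta>_def)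
  \<comment> \<open>Both sides equal 1.\<close>
  have "Gamma_sum D * st_lower S' = Gamma_sum D * (\<theta> * r + (1 - \<theta>) * st_lower S)"
    using lower_next norm_lower_combination G by (simp add: \<theta>_def r_def algebra_simps)
  then have low: "st_lower S' = \<theta> * r + (1 - \<theta>) * st_lower S"
    using G by simp
  have up: "st_upper S' = min r (st_upper S)"
    using iter by (simp add: iteration_def r_def)
  \<comment> \<open>The minimum is split so that one share is bounded by r and the other by the old
    upper bound; the r terms then cancel against \<open>low\<close>.\<close>
  have "st_upper S' = \<theta> * st_upper S' + (1 - \<theta>) * st_upper S'"
    by (simp add: algebra_simps)
  also have "\<dots> \<le> \<theta> * r + (1 - \<theta>) * st_upper S"
    using \<theta> by (intro add_mono mult_left_mono) (auto simp: up)
  finally show ?thesis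
    by (simp add: low algebra_simps flip: \<theta>_def)
qed

end

lemma level_state_run:
  assumes "algorithm_run \<phi> L \<epsilon> k S D" "1 \<le> j" "j \<le> k"
  shows "level_state \<phi> L (S j)"
  using assms(2,3)
proof (induction j rule: dec_induct)
  case base
  then show ?case
    using assms(1) level_state_initial by (auto simp: algorithm_run_def)
next
  case (step j)
  then have "iteration \<phi> L (S j) (D j) (S (Suc j))"
    using assms(1) by (auto simp: algorithm_run_def)
  then show ?case
    using step by (auto intro: level_state_iteration)
qed

theorem theorem5:
  fixes \<phi> :: "'n::finite \<Rightarrow> 'q::metric_space \<Rightarrow>\<^sub>C real"
    and L :: "('q \<Rightarrow>\<^sub>C real) \<Rightarrow> real"
    and \<epsilon> :: real
    and k :: nat
    and S :: "nat \<Rightarrow> ('q, 'n) alg_state"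
    and D :: "nat \<Rightarrow> ('q, 'n) iter_data"
  assumes "compact (UNIV :: 'q set)"
    and "inj \<phi>" and "independent (range \<phi>)"
    and "linear_functional_on (poly_span \<phi>) L"
    and "\<exists>p\<in>poly_span \<phi>. L p \<noteq> 0"
    and "\<epsilon> > 0"
    and "k \<ge> 1"
    and "algorithm_run \<phi> L \<epsilon> k S D"
  shows "st_upper (S (Suc k)) - st_lower (S (Suc k))
           \<le> (1 - gamma0 (D k) / Gamma_sum (D k)) * (st_upper (S k) - st_lower (S k))"
proof (rule gap_iteration)
  show "level_state \<phi> L (S k)"
    using assms by (auto intro: level_state_run)
  show "iteration \<phi> L (S k) (D k) (S (Suc k))"
    using assms by (auto simp: algorithm_run_def)
qed

end
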